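(* Let $S=A+B$ with $A=QQ^*\in\mathbb{C}^{n\times n}$ Hermitian positive definite, $Q\in\mathbb{C}^{n\times n}$, and $B\in\mathbb{C}^{n\times n}$ Hermitian positive semidefinite, let $G=Q^{-1}BQ^{-*}$, let $r<\operatorname{rank}(B)$ be a positive integer, and let $G_r$ be a rank-$r$ truncated SVD of $G$. When $\operatorname{rank}(G)<n$, $G_r$ is a minimiser of the problem $$\begin{aligned}\text{minimise over } X\in\mathbb{H}^n_+\quad & \kappa_2\big(P^{-1/2}SP^{-1/2}\big)\\ \text{subject to}\quad & P=Q(I+X)Q^*,\\ &\operatorname{rank}(X)\le r.\end{aligned}$$
   Context: $\mathbb{H}^n_+$ denotes the cone of Hermitian positive semidefinite $n\times n$ matrices. $M^*$ is the conjugate transpose, $M^{-*}=(M^{-1})^*$. For a nonsingular normal matrix $M$, $\kappa_2(M)=\sigma_1(M)/\sigma_n(M)$ is the $\ell_2$ condition number, with $\sigma_1(M)\ge\cdots\ge\sigma_n(M)$ the singular values. $P^{-1/2}$ is the inverse of the Hermitian positive definite square root of $P$. A rank-$r$ truncated SVD of a Hermitian positive semidefinite $M=\sum_{i}\lambda_i(M)v_iv_i^*$ ($v_i$ orthonormal eigenvectors, eigenvalues $\lambda_i(M)$ in nonincreasing order) is $M_r=\sum_{i=1}^r\lambda_i(M)v_iv_i^*$. *)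

theory Defs
  imports
    "Jordan_Normal_Form.Schur_Decomposition"
    "Jordan_Normal_Form.DL_Rank"
    "Jordan_Normal_Form.Gauss_Jordan_Elimination"
    "HOL-Library.Multiset"
begin

definition hermitian_mat :: "nat \<Rightarrow> complex mat \<Rightarrow> bool" where
  "hermitian_mat n M \<longleftrightarrow> M \<in> carrier_mat n n \<and> mat_adjoint M = M"

text \<open>Since \<open>x \<bullet>c y\<close> conjugates its second argument, \<open>(M *\<^sub>v x) \<bullet>c x\<close> is the quadratic form of
  \<open>M\<close> at \<open>x\<close>; it is real when \<open>M\<close> is Hermitian.\<close>

definition psd_mat :: "nat \<Rightarrow> complex mat \<Rightarrow> bool" where
  "psd_mat n M \<longleftrightarrow> hermitian_mat n M \<and> (\<forall>x\<in>carrier_vec n. 0 \<le> Re ((M *\<^sub>v x) \<bullet>c x))"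

definition pd_mat :: "nat \<Rightarrow> complex mat \<Rightarrow> bool" where
  "pd_mat n M \<longleftrightarrow>
     hermitian_mat n M \<and> (\<forall>x\<in>carrier_vec n. x \<noteq> 0\<^sub>v n \<longrightarrow> 0 < Re ((M *\<^sub>v x) \<bullet>c x))"

text \<open>The inverse is meaningful only for invertible matrices.\<close>

definition mat_inv :: "complex mat \<Rightarrow> complex mat" where
  "mat_inv M = the (mat_inverse M)"

text \<open>The Hermitian positive definite square root is meaningful only for Hermitian positive definite
  matrices, for which it is unique.\<close>

definition mat_sqrt :: "complex mat \<Rightarrow> complex mat" where
  "mat_sqrt P = (THE R. pd_mat (dim_row P) R \<and> R * R = P)"

text \<open>Singular values in nonincreasing order and with multiplicity: the square roots of the
  eigenvalues of \<open>M\<^sup>* M\<close>. These are real and nonnegative, so \<open>Re\<close> loses nothing.\<close>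

definition singular_values :: "complex mat \<Rightarrow> real list" where
  "singular_values M =
     rev (sorted_list_of_multiset
       (image_mset (\<lambda>z. sqrt (Re z)) (proots (char_poly (mat_adjoint M * M)))))"

text \<open>Indexed from 1, as usual for singular values.\<close>

definition singular_value :: "complex mat \<Rightarrow> nat \<Rightarrow> real" where
  "singular_value M i = singular_values M ! (i - 1)"

definition cond2 :: "complex mat \<Rightarrow> real" where
  "cond2 M = singular_value M 1 / singular_value M (dim_row M)"

text \<open>The matrix \<open>\<Sum>i<k. l i \<cdot> (v i)(v i)\<^sup>*\<close>.\<close>

definition spectral_sum :: "nat \<Rightarrow> nat \<Rightarrow> (nat \<Rightarrow> real) \<Rightarrow> (nat \<Rightarrow> complex vec) \<Rightarrow> complex mat" where
  "spectral_sum n k l v =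
     mat n n (\<lambda>(a, b). \<Sum>i<k. complex_of_real (l i) * v i $ a * cnj (v i $ b))"

definition spectral_decomposition ::
    "nat \<Rightarrow> complex mat \<Rightarrow> (nat \<Rightarrow> real) \<Rightarrow> (nat \<Rightarrow> complex vec) \<Rightarrow> bool" where
  "spectral_decomposition n M l v \<longleftrightarrow>
     (\<forall>i<n. v i \<in> carrier_vec n) \<and>
     (\<forall>i<n. \<forall>j<n. v i \<bullet>c v j = (if i = j then 1 else 0)) \<and>
     (\<forall>i<n. M *\<^sub>v v i = complex_of_real (l i) \<cdot>\<^sub>v v i) \<and>
     (\<forall>i j. i \<le> j \<longrightarrow> j < n \<longrightarrow> l j \<le> l i) \<and>
     M = spectral_sum n n l v"

text \<open>A truncated SVD need not be unique (ties \<open>l (r - 1) = l r\<close>), hence a relation. The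
  eigenvalue indices here start at 0.\<close>

definition is_truncated_svd :: "nat \<Rightarrow> nat \<Rightarrow> complex mat \<Rightarrow> complex mat \<Rightarrow> bool" where
  "is_truncated_svd n r M Mr \<longleftrightarrow>
     psd_mat n M \<and> r \<le> n \<and> (\<exists>l v. spectral_decomposition n M l v \<and> Mr = spectral_sum n r l v)"

end

theory Submission
  imports Defs
begin

text \<open>Write \<open>K = I + G\<close>, so that \<open>S = Q K Q\<^sup>*\<close>, and \<open>T = I + X\<close>, so that \<open>P = Q T Q\<^sup>*\<close>. The
  preconditioned matrix is congruent to \<open>K\<close> by a matrix under which \<open>T\<close> becomes the identity
  (\<open>cond2_preconditioned_eq_rayleigh\<close>). Its condition number is therefore \<open>b / a\<close>, where \<open>b\<close> and \<open>a\<close>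
  are the largest and the smallest value of the quotient \<open>\<langle>K z, z\<rangle> / \<langle>T z, z\<rangle>\<close> over nonzero \<open>z\<close>, and the
  whole question is about this quotient.

  Let \<open>l\<^sub>0 \<ge> \<dots> \<ge> l\<^sub>n\<^sub>-\<^sub>1 \<ge> 0\<close> be the eigenvalues of \<open>G\<close> with orthonormal eigenvectors \<open>v\<^sub>i\<close>. The optimal
  value is \<open>1 + l\<^sub>r\<close>.

  Lower bound, for a feasible \<open>X\<close>: a nonzero \<open>z\<close> in the kernel of the singular matrix \<open>G\<close> has quotient
  \<open>\<parallel>z\<parallel>\<^sup>2 / (\<parallel>z\<parallel>\<^sup>2 + \<langle>X z, z\<rangle>) \<le> 1\<close>, hence \<open>a \<le> 1\<close>. As \<open>X\<close> has rank at most \<open>r\<close>, its kernel meets the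
  \<open>(r + 1)\<close>-dimensional span of \<open>v\<^sub>0, \<dots>, v\<^sub>r\<close> (\<open>psd_kernel_meets_span\<close>). At such a vector \<open>T\<close> acts as the
  identity while \<open>G\<close> is at least \<open>l\<^sub>r\<close>, hence \<open>b \<ge> 1 + l\<^sub>r\<close>.

  Upper bound, for \<open>X = G\<^sub>r\<close>: both forms are diagonal in the basis \<open>v\<^sub>i\<close>, with quotients \<open>1\<close> for \<open>i < r\<close>
  and \<open>1 + l\<^sub>i\<close> for \<open>i \<ge> r\<close>; so \<open>a \<ge> 1\<close> and \<open>b \<le> 1 + l\<^sub>r\<close>.

  The supporting theory consists of the spectral theorem for Hermitian matrices, obtained by deflation,
  and its consequences: existence and uniqueness of the positive definite square root, and the
  identification of the singular values of a positive definite matrix with its eigenvalues.\<close>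

section \<open>Adjoints and quadratic forms\<close>

lemma dim_mat_adjoint [simp]:
  "dim_row (mat_adjoint M) = dim_col M" "dim_col (mat_adjoint M) = dim_row M"
  unfolding mat_adjoint_def by simp_all

lemma mat_adjoint_carrier [simp]:
  assumes "M \<in> carrier_mat n m"
  shows "mat_adjoint M \<in> carrier_mat m n"
  by (rule carrier_matI) (simp_all add: carrier_matD[OF assms])

lemma index_mat_adjoint [simp]:
  fixes M :: "complex mat"
  assumes "i < dim_col M" "j < dim_row M"
  shows "mat_adjoint M $$ (i, j) = cnj (M $$ (j, i))"
  using assms unfolding mat_adjoint_def by (simp add: mat_of_rows_index)

lemma mat_adjoint_adjoint [simp]: "mat_adjoint (mat_adjoint M) = (M :: complex mat)"
  by (rule eq_matI) simp_all

lemma mat_adjoint_mult: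
  fixes A B :: "complex mat"
  assumes "A \<in> carrier_mat n m" "B \<in> carrier_mat m k"
  shows "mat_adjoint (A * B) = mat_adjoint B * mat_adjoint A"
proof (rule eq_matI)
  fix i j assume "i < dim_row (mat_adjoint B * mat_adjoint A)"
    "j < dim_col (mat_adjoint B * mat_adjoint A)"
  then have ij: "i < k" "j < n" using assms by auto
  have "mat_adjoint (A * B) $$ (i, j) = (\<Sum>a<m. cnj (A $$ (j, a)) * cnj (B $$ (a, i)))"
    using ij assms by (simp add: scalar_prod_def atLeast0LessThan)
  also have "\<dots> = (mat_adjoint B * mat_adjoint A) $$ (i, j)"
    using ij assms by (simp add: scalar_prod_def atLeast0LessThan mult.commute)
  finally show "mat_adjoint (A * B) $$ (i, j) = (mat_adjoint B * mat_adjoint A) $$ (i, j)" .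
qed (use assms in auto)

lemma cscalar_prod_mat_adjoint:
  fixes M :: "complex mat"
  assumes M: "M \<in> carrier_mat n m" and x: "x \<in> carrier_vec m" and y: "y \<in> carrier_vec n"
  shows "(M *\<^sub>v x) \<bullet>c y = x \<bullet>c (mat_adjoint M *\<^sub>v y)"
proof -
  have "(M *\<^sub>v x) \<bullet>c y = (\<Sum>a<n. \<Sum>b<m. M $$ (a, b) * x $ b * cnj (y $ a))"
    using M x y by (auto simp: scalar_prod_def sum_distrib_right atLeast0LessThan intro!: sum.cong)
  also have "\<dots> = (\<Sum>b<m. \<Sum>a<n. M $$ (a, b) * x $ b * cnj (y $ a))"
    by (rule sum.swap)
  also have "\<dots> = x \<bullet>c (mat_adjoint M *\<^sub>v y)"
    using M x y
    by (simp add: scalar_prod_def sum_distrib_left atLeast0LessThan mult_ac)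
  finally show ?thesis .
qed

lemma cscalar_prod_commute:
  fixes x y :: "complex vec"
  assumes "x \<in> carrier_vec n" "y \<in> carrier_vec n"
  shows "y \<bullet>c x = cnj (x \<bullet>c y)"
  using assms by (auto simp: scalar_prod_def mult.commute intro!: sum.cong)

lemma hermitian_matI:
  assumes "M \<in> carrier_mat n n" "\<And>i j. i < n \<Longrightarrow> j < n \<Longrightarrow> M $$ (i, j) = cnj (M $$ (j, i))"
  shows "hermitian_mat n M"
proof -
  have "mat_adjoint M = M"
  proof (rule eq_matI)
    fix i j assume "i < dim_row M" "j < dim_col M"
    then show "mat_adjoint M $$ (i, j) = M $$ (i, j)"
      using assms(1) assms(2)[of i j] by auto
  qed (use assms(1) in auto)
  then show ?thesis using assms(1) unfolding hermitian_mat_def by simp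
qed

lemma hermitian_matD:
  assumes "hermitian_mat n M"
  shows "M \<in> carrier_mat n n" "mat_adjoint M = M"
    "i < n \<Longrightarrow> j < n \<Longrightarrow> M $$ (i, j) = cnj (M $$ (j, i))"
  using assms index_mat_adjoint[of i M j] unfolding hermitian_mat_def by auto

lemma hermitian_mat_one: "hermitian_mat n (1\<^sub>m n)"
  by (rule hermitian_matI) auto

lemma hermitian_mat_add:
  assumes "hermitian_mat n A" "hermitian_mat n B"
  shows "hermitian_mat n (A + B)"
proof (rule hermitian_matI)
  fix i j assume ij: "i < n" "j < n"
  show "(A + B) $$ (i, j) = cnj ((A + B) $$ (j, i))"
    using ij hermitian_matD(1)[OF assms(1)] hermitian_matD(1)[OF assms(2)]
      hermitian_matD(3)[OF assms(1) ij] hermitian_matD(3)[OF assms(2) ij]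
    by simp
qed (use hermitian_matD(1)[OF assms(1)] hermitian_matD(1)[OF assms(2)] in auto)

lemma hermitian_mat_minus:
  assumes "hermitian_mat n A" "hermitian_mat n B"
  shows "hermitian_mat n (A - B)"
proof (rule hermitian_matI)
  fix i j assume ij: "i < n" "j < n"
  show "(A - B) $$ (i, j) = cnj ((A - B) $$ (j, i))"
    using ij hermitian_matD(1)[OF assms(1)] hermitian_matD(1)[OF assms(2)]
      hermitian_matD(3)[OF assms(1) ij] hermitian_matD(3)[OF assms(2) ij]
    by simp
qed (use hermitian_matD(1)[OF assms(1)] hermitian_matD(1)[OF assms(2)] in auto)

lemma cscalar_prod_hermitian:
  assumes "hermitian_mat n M" "x \<in> carrier_vec n" "y \<in> carrier_vec n"
  shows "(M *\<^sub>v x) \<bullet>c y = x \<bullet>c (M *\<^sub>v y)"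
  using cscalar_prod_mat_adjoint[of M n n x y] hermitian_matD(1,2)[OF assms(1)] assms(2,3) by simp

text \<open>The squared norm of \<open>x\<close> appears throughout as \<open>quad_form (1\<^sub>m n) x\<close>, the form of the identity, so
  that Rayleigh quotients and quotients of two general forms are treated alike.\<close>

definition quad_form :: "complex mat \<Rightarrow> complex vec \<Rightarrow> real" where
  "quad_form M x = Re ((M *\<^sub>v x) \<bullet>c x)"

lemma quad_form_add:
  assumes "A \<in> carrier_mat n n" "B \<in> carrier_mat n n" "x \<in> carrier_vec n"
  shows "quad_form (A + B) x = quad_form A x + quad_form B x"
  using assms unfolding quad_form_def
  by (simp add: add_mult_distrib_mat_vec[of _ n n] add_scalar_prod_distrib[of _ n])

lemma quad_form_one:
  assumes "x \<in> carrier_vec n"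
  shows "quad_form (1\<^sub>m n) x = (\<Sum>a<n. (cmod (x $ a))\<^sup>2)"
  using assms unfolding quad_form_def
  by (simp add: scalar_prod_def atLeast0LessThan cmod_power2 sum.distrib flip: power2_eq_square)

lemma cscalar_prod_self:
  assumes "x \<in> carrier_vec n"
  shows "x \<bullet>c x = complex_of_real (quad_form (1\<^sub>m n) x)"
  using assms unfolding quad_form_one[OF assms]
  by (auto simp: scalar_prod_def atLeast0LessThan complex_norm_square
      simp del: of_real_power intro!: sum.cong)

lemma quad_form_one_pos:
  assumes "x \<in> carrier_vec n" "x \<noteq> 0\<^sub>v n"
  shows "0 < quad_form (1\<^sub>m n) x"
proof -
  have "0 \<le> quad_form (1\<^sub>m n) x" unfolding quad_form_one[OF assms(1)] by (simp add: sum_nonneg)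
  moreover have "quad_form (1\<^sub>m n) x \<noteq> 0"
    using conjugate_square_eq_0_vec[OF assms(1)] assms(2) cscalar_prod_self[OF assms(1)] by auto
  ultimately show ?thesis by simp
qed

lemma pd_matD:
  assumes "pd_mat n M"
  shows "hermitian_mat n M" "M \<in> carrier_mat n n"
    "x \<in> carrier_vec n \<Longrightarrow> x \<noteq> 0\<^sub>v n \<Longrightarrow> 0 < quad_form M x"
  using assms unfolding pd_mat_def hermitian_mat_def quad_form_def by auto

lemma psd_matD:
  assumes "psd_mat n M"
  shows "hermitian_mat n M" "M \<in> carrier_mat n n"
    "x \<in> carrier_vec n \<Longrightarrow> 0 \<le> quad_form M x"
  using assms unfolding psd_mat_def hermitian_mat_def quad_form_def by auto

lemma pd_mat_one_plus_psd:
  assumes "psd_mat n X"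
  shows "pd_mat n (1\<^sub>m n + X)"
  using hermitian_mat_add[OF hermitian_mat_one psd_matD(1)[OF assms]]
    quad_form_add[of "1\<^sub>m n" n X] psd_matD(2,3)[OF assms] quad_form_one_pos
  unfolding pd_mat_def quad_form_def[symmetric] by (auto simp: add_pos_nonneg)

section \<open>The spectral theorem\<close>

definition orthonormal_family :: "nat \<Rightarrow> nat \<Rightarrow> (nat \<Rightarrow> complex vec) \<Rightarrow> bool" where
  "orthonormal_family n k v \<longleftrightarrow> (\<forall>i<k. v i \<in> carrier_vec n) \<and>
     (\<forall>i<k. \<forall>j<k. v i \<bullet>c v j = (if i = j then 1 else 0))"

lemma orthonormal_familyD:
  assumes "orthonormal_family n k v"
  shows "i < k \<Longrightarrow> v i \<in> carrier_vec n"
    "i < k \<Longrightarrow> j < k \<Longrightarrow> v i \<bullet>c v j = (if i = j then 1 else 0)"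
  using assms unfolding orthonormal_family_def by simp_all

lemma spectral_sum_carrier [simp]: "spectral_sum n k l v \<in> carrier_mat n n"
  unfolding spectral_sum_def by simp

lemma hermitian_spectral_sum: "hermitian_mat n (spectral_sum n k l v)"
  by (rule hermitian_matI) (auto simp: spectral_sum_def mult_ac intro!: sum.cong)

lemma spectral_sum_mult_vec_index:
  assumes v: "\<And>i. i < k \<Longrightarrow> v i \<in> carrier_vec n" and x: "x \<in> carrier_vec n" and a: "a < n"
  shows "(spectral_sum n k l v *\<^sub>v x) $ a = (\<Sum>i<k. complex_of_real (l i) * (x \<bullet>c v i) * v i $ a)"
proof -
  have "(spectral_sum n k l v *\<^sub>v x) $ a
      = (\<Sum>b<n. \<Sum>i<k. complex_of_real (l i) * v i $ a * cnj (v i $ b) * x $ b)"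
    using x a unfolding spectral_sum_def
    by (auto simp: scalar_prod_def atLeast0LessThan sum_distrib_right intro!: sum.cong)
  also have "\<dots> = (\<Sum>i<k. \<Sum>b<n. complex_of_real (l i) * v i $ a * cnj (v i $ b) * x $ b)"
    by (rule sum.swap)
  also have "\<dots> = (\<Sum>i<k. complex_of_real (l i) * (x \<bullet>c v i) * v i $ a)"
  proof (rule sum.cong[OF refl])
    fix i assume "i \<in> {..<k}"
    then have "dim_vec (v i) = n" using v by simp
    then show "(\<Sum>b<n. complex_of_real (l i) * v i $ a * cnj (v i $ b) * x $ b)
        = complex_of_real (l i) * (x \<bullet>c v i) * v i $ a"
      using x by (simp add: scalar_prod_def atLeast0LessThan sum_distrib_left mult_ac)
  qed
  finally show ?thesis .
qed

lemma spectral_sum_mult_eigenvector: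
  assumes on: "orthonormal_family n m v" and k: "k \<le> m" and j: "j < m"
  shows "spectral_sum n k l v *\<^sub>v v j = (if j < k then complex_of_real (l j) \<cdot>\<^sub>v v j else 0\<^sub>v n)"
proof (rule eq_vecI)
  have v: "\<And>i. i < m \<Longrightarrow> v i \<in> carrier_vec n"
    and o: "\<And>i. i < m \<Longrightarrow> v j \<bullet>c v i = (if i = j then 1 else 0)"
    using on j unfolding orthonormal_family_def by auto
  fix a assume "a < dim_vec (if j < k then complex_of_real (l j) \<cdot>\<^sub>v v j else 0\<^sub>v n)"
  then have a: "a < n" using v[OF j] by (auto split: if_splits)
  have "(spectral_sum n k l v *\<^sub>v v j) $ a = (\<Sum>i<k. complex_of_real (l i) * (v j \<bullet>c v i) * v i $ a)"
    using v j k a by (intro spectral_sum_mult_vec_index) auto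
  also have "\<dots> = (\<Sum>i<k. if i = j then complex_of_real (l i) * v i $ a else 0)"
    using k o by (intro sum.cong) auto
  finally show "(spectral_sum n k l v *\<^sub>v v j) $ a
      = (if j < k then complex_of_real (l j) \<cdot>\<^sub>v v j else 0\<^sub>v n) $ a"
    using a carrier_vecD[OF v[OF j]] by simp
qed (use on j in \<open>auto simp: orthonormal_family_def spectral_sum_def\<close>)

lemma spectral_sum_mult_orthogonal:
  assumes "\<And>i. i < k \<Longrightarrow> v i \<in> carrier_vec n" "x \<in> carrier_vec n" "\<And>i. i < k \<Longrightarrow> x \<bullet>c v i = 0"
  shows "spectral_sum n k l v *\<^sub>v x = 0\<^sub>v n"
proof (rule eq_vecI)
  fix a assume "a < dim_vec (0\<^sub>v n :: complex vec)"
  then show "(spectral_sum n k l v *\<^sub>v x) $ a = 0\<^sub>v n $ a"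
    using spectral_sum_mult_vec_index[OF assms(1,2), where k = k and a = a and l = l] assms(3) by simp
qed (auto simp: spectral_sum_def)

lemma quad_form_spectral_sum:
  assumes v: "\<And>i. i < k \<Longrightarrow> v i \<in> carrier_vec n" and x: "x \<in> carrier_vec n"
  shows "quad_form (spectral_sum n k l v) x = (\<Sum>i<k. l i * (cmod (x \<bullet>c v i))\<^sup>2)"
proof -
  have "(spectral_sum n k l v *\<^sub>v x) \<bullet>c x
      = (\<Sum>a<n. \<Sum>i<k. complex_of_real (l i) * (x \<bullet>c v i) * v i $ a * cnj (x $ a))"
    using x spectral_sum_mult_vec_index[OF v x, where k = k]
    unfolding scalar_prod_def[of "spectral_sum n k l v *\<^sub>v x"]
    by (auto simp: atLeast0LessThan sum_distrib_right intro!: sum.cong)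
  also have "\<dots> = (\<Sum>i<k. \<Sum>a<n. complex_of_real (l i) * (x \<bullet>c v i) * v i $ a * cnj (x $ a))"
    by (rule sum.swap)
  also have "\<dots> = (\<Sum>i<k. complex_of_real (l i) * (x \<bullet>c v i) * (v i \<bullet>c x))"
    using x by (simp add: scalar_prod_def[of _ "conjugate x"] atLeast0LessThan sum_distrib_left
        mult.assoc)
  also have "\<dots> = (\<Sum>i<k. complex_of_real (l i * (cmod (x \<bullet>c v i))\<^sup>2))"
  proof (rule sum.cong[OF refl])
    fix i assume "i \<in> {..<k}"
    then have "v i \<bullet>c x = cnj (x \<bullet>c v i)" using cscalar_prod_commute[OF x v] by simp
    then show "complex_of_real (l i) * (x \<bullet>c v i) * (v i \<bullet>c x)
        = complex_of_real (l i * (cmod (x \<bullet>c v i))\<^sup>2)"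
      by (simp add: complex_norm_square mult.assoc del: of_real_power)
  qed
  finally show ?thesis unfolding quad_form_def by simp
qed

lemma psd_spectral_sum:
  assumes "\<And>i. i < k \<Longrightarrow> v i \<in> carrier_vec n" "\<And>i. i < k \<Longrightarrow> 0 \<le> l i"
  shows "psd_mat n (spectral_sum n k l v)"
  using assms quad_form_spectral_sum[OF assms(1), of k]
  unfolding psd_mat_def quad_form_def[symmetric]
  by (auto intro!: hermitian_spectral_sum sum_nonneg)

lemma rank_spectral_sum_le: "vec_space.rank n (spectral_sum n k l v) \<le> k"
proof (induction k)
  case 0
  have "spectral_sum n 0 l v = 0\<^sub>m n n" by (rule eq_matI) (auto simp: spectral_sum_def)
  then show ?case by (simp add: vec_space.rank_0I)
next
  case (Suc k)
  define R where "R = mat n n (\<lambda>(a, b). complex_of_real (l k) * v k $ a * cnj (v k $ b))"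
  have R: "R \<in> carrier_mat n n" unfolding R_def by simp
  have "spectral_sum n (Suc k) l v = spectral_sum n k l v + R"
    by (rule eq_matI) (auto simp: spectral_sum_def R_def)
  moreover have "vec_space.rank n R \<le> 1"
    by (rule vec_space.rank_le_1_product_entries[OF R]) (auto simp: R_def)
  ultimately show ?case
    using vec_space.rank_subadditive[OF spectral_sum_carrier R] Suc.IH
    by (metis Suc_eq_plus1 add_mono order_trans)
qed

lemma singular_mat_kernel_vec:
  fixes M :: "complex mat"
  assumes M: "M \<in> carrier_mat n n" and r: "vec_space.rank n M < n"
  obtains x where "x \<in> carrier_vec n" "x \<noteq> 0\<^sub>v n" "M *\<^sub>v x = 0\<^sub>v n"
  using vec_space.det_rank_iff[OF M] det_0_iff_vec_prod_zero[OF M] r by auto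

text \<open>If all eigenvalues of \<open>N\<close> vanish, then its Schur form is strictly upper triangular, so
  \<open>trace (N\<^sup>2) = 0\<close>; but for Hermitian \<open>N\<close> this trace is the sum of the squared moduli of the
  entries.\<close>

lemma hermitian_nonzero_eigenvalue:
  assumes N: "hermitian_mat n N" and N0: "N \<noteq> 0\<^sub>m n n"
  obtains x \<mu> where "x \<in> carrier_vec n" "x \<noteq> 0\<^sub>v n" "\<mu> \<noteq> 0" "N *\<^sub>v x = complex_of_real \<mu> \<cdot>\<^sub>v x"
proof -
  note Nc = hermitian_matD(1)[OF N]
  have "\<exists>e. eigenvalue N e \<and> e \<noteq> 0"
  proof (rule ccontr)
    assume "\<nexists>e. eigenvalue N e \<and> e \<noteq> 0"
    then have ev0: "\<And>e. eigenvalue N e \<Longrightarrow> e = 0" by blast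
    obtain es where cp: "char_poly N = (\<Prod>e\<leftarrow>es. [:- e, 1:])"
      using char_poly_factorized[OF Nc] by blast
    obtain T P R where "schur_decomposition N es = (T, P, R)" by (metis prod_cases3)
    from schur_decomposition[OF Nc cp this]
    have sim: "similar_mat_wit N T P R" and ut: "upper_triangular T" and dg: "diag_mat T = es"
      by auto
    have T: "T \<in> carrier_mat n n" and P: "P \<in> carrier_mat n n" and R: "R \<in> carrier_mat n n"
      and RP: "R * P = 1\<^sub>m n" and NPTR: "N = P * T * R"
      using sim Nc unfolding similar_mat_wit_def Let_def by auto
    have diag0: "T $$ (i, i) = 0" if "i < n" for i
    proof -
      have "T $$ (i, i) \<in> set es" using dg that T unfolding diag_mat_def by auto
      then have "poly (char_poly N) (T $$ (i, i)) = 0" unfolding cp by (rule linear_poly_root)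
      then show ?thesis using ev0 eigenvalue_root_char_poly[OF Nc] by blast
    qed
    define tr where "tr = (\<lambda>M :: complex mat. \<Sum>i<n. M $$ (i, i))"
    have tr_mult: "tr (A * B) = (\<Sum>i<n. \<Sum>j<n. A $$ (i, j) * B $$ (j, i))"
      if "A \<in> carrier_mat n n" "B \<in> carrier_mat n n" for A B
      using that unfolding tr_def
      by (auto simp: scalar_prod_def atLeast0LessThan intro!: sum.cong)
    have tr_comm: "tr (A * B) = tr (B * A)"
      if "A \<in> carrier_mat n n" "B \<in> carrier_mat n n" for A B
      unfolding tr_mult[OF that] tr_mult[OF that(2,1)]
      by (subst sum.swap) (simp add: mult.commute)
    \<comment> \<open>Cyclicity of the trace moves \<open>P\<close> to the end of \<open>N * N = P * T * R * N\<close>, and \<open>R * N * P = T\<close>.\<close>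
    have "R * (N * P) = R * P * T * (R * P)"
      unfolding NPTR using P T R by (simp add: assoc_mult_mat[of _ n n _ n _ n])
    then have RNP: "R * (N * P) = T" unfolding RP using T by simp
    have "N * N = P * (T * (R * N))"
      using arg_cong[OF NPTR, of "\<lambda>M. M * N"] P T R Nc
      by (simp add: assoc_mult_mat[of _ n n _ n _ n])
    then have "tr (N * N) = tr (T * (R * N) * P)"
      using tr_comm[of P "T * (R * N)"] P T R Nc by simp
    also have "T * (R * N) * P = T * (R * (N * P))"
      using P T R Nc by (simp add: assoc_mult_mat[of _ n n _ n _ n])
    also have "tr (T * (R * (N * P))) = (\<Sum>i<n. \<Sum>j<n. T $$ (i, j) * T $$ (j, i))"
      unfolding RNP using tr_mult[OF T T] .
    also have "\<dots> = 0"
    proof (intro sum.neutral ballI)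
      fix i j assume "i \<in> {..<n}" "j \<in> {..<n}"
      moreover have "i < j \<or> i = j \<or> j < i" by auto
      ultimately show "T $$ (i, j) * T $$ (j, i) = 0"
        using ut diag0 T unfolding upper_triangular_def by auto
    qed
    finally have "(\<Sum>i<n. \<Sum>j<n. N $$ (i, j) * N $$ (j, i)) = 0"
      using tr_mult[OF Nc Nc] by simp
    moreover have "(\<Sum>i<n. \<Sum>j<n. N $$ (i, j) * N $$ (j, i))
        = complex_of_real (\<Sum>i<n. \<Sum>j<n. (cmod (N $$ (i, j)))\<^sup>2)"
    proof -
      have "N $$ (i, j) * N $$ (j, i) = complex_of_real ((cmod (N $$ (i, j)))\<^sup>2)"
        if "i < n" "j < n" for i j
        using hermitian_matD(3)[OF N that(2,1)] by (simp add: complex_norm_square del: of_real_power)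
      then show ?thesis unfolding of_real_sum by (intro sum.cong refl) simp_all
    qed
    ultimately have "(\<Sum>i<n. \<Sum>j<n. (cmod (N $$ (i, j)))\<^sup>2) = 0"
      by (simp only: of_real_eq_0_iff)
    then have "\<And>i j. i < n \<Longrightarrow> j < n \<Longrightarrow> N $$ (i, j) = 0"
      by (simp add: sum_nonneg_eq_0_iff sum_nonneg)
    then have "N = 0\<^sub>m n n" using Nc by (intro eq_matI) auto
    then show False using N0 by simp
  qed
  then obtain e x where e0: "e \<noteq> 0" and x: "x \<in> carrier_vec n" "x \<noteq> 0\<^sub>v n"
    and Nx: "N *\<^sub>v x = e \<cdot>\<^sub>v x"
    using Nc unfolding eigenvalue_def eigenvector_def by auto
  have "e * (x \<bullet>c x) = (N *\<^sub>v x) \<bullet>c x" unfolding Nx using x by simp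
  also have "\<dots> = x \<bullet>c (e \<cdot>\<^sub>v x)" using cscalar_prod_hermitian[OF N x(1) x(1)] Nx by simp
  also have "\<dots> = cnj e * (x \<bullet>c x)" using x by (simp add: conjugate_smult_vec)
  finally have "e = cnj e" using x by simp
  then have "Im e = 0" by (simp add: complex_eq_iff)
  then have er: "e = complex_of_real (Re e)" and "Re e \<noteq> 0"
    using e0 by (auto simp: complex_eq_iff)
  moreover have "N *\<^sub>v x = complex_of_real (Re e) \<cdot>\<^sub>v x"
    unfolding Nx er[symmetric] ..
  ultimately show ?thesis using that x by blast
qed

text \<open>The deflation step: for an eigenvector \<open>x\<close> with eigenvalue \<open>\<mu> \<noteq> 0\<close>,
  \<open>\<mu> \<langle>x, v i\<rangle> = \<langle>N x, v i\<rangle> = \<langle>x, N (v i)\<rangle> = 0\<close>.\<close>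

lemma hermitian_eigenvector_orthogonal:
  assumes N: "hermitian_mat n N" and N0: "N \<noteq> 0\<^sub>m n n"
    and v: "\<And>i. i < k \<Longrightarrow> v i \<in> carrier_vec n" and Nv: "\<And>i. i < k \<Longrightarrow> N *\<^sub>v v i = 0\<^sub>v n"
  obtains x \<mu> where "x \<in> carrier_vec n" "x \<bullet>c x = 1" "\<And>i. i < k \<Longrightarrow> x \<bullet>c v i = 0"
    "N *\<^sub>v x = complex_of_real \<mu> \<cdot>\<^sub>v x"
proof -
  obtain x \<mu> where x: "x \<in> carrier_vec n" "x \<noteq> 0\<^sub>v n" and \<mu>: "\<mu> \<noteq> 0"
    and Nx: "N *\<^sub>v x = complex_of_real \<mu> \<cdot>\<^sub>v x"
    using hermitian_nonzero_eigenvalue[OF N N0] by blast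
  have orth: "x \<bullet>c v i = 0" if "i < k" for i
  proof -
    have "complex_of_real \<mu> * (x \<bullet>c v i) = (N *\<^sub>v x) \<bullet>c v i"
      unfolding Nx using x v[OF that] by simp
    also have "\<dots> = x \<bullet>c (N *\<^sub>v v i)"
      by (rule cscalar_prod_hermitian[OF N x(1) v[OF that]])
    also have "\<dots> = 0" unfolding Nv[OF that] using x by simp
    finally show ?thesis using \<mu> by simp
  qed
  define q where "q = quad_form (1\<^sub>m n) x"
  define c where "c = complex_of_real (1 / sqrt q)"
  have q: "0 < q" unfolding q_def using x by (rule quad_form_one_pos)
  have "c * cnj c * complex_of_real q = 1"
    unfolding c_def using q by (simp flip: of_real_mult)
  then have "(c \<cdot>\<^sub>v x) \<bullet>c (c \<cdot>\<^sub>v x) = 1"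
    using x cscalar_prod_self[OF x(1)] by (simp add: conjugate_smult_vec q_def[symmetric] mult_ac)
  moreover have "(c \<cdot>\<^sub>v x) \<bullet>c v i = 0" if "i < k" for i
    using orth[OF that] x v[OF that] by simp
  moreover have "N *\<^sub>v (c \<cdot>\<^sub>v x) = complex_of_real \<mu> \<cdot>\<^sub>v (c \<cdot>\<^sub>v x)"
    using mult_mat_vec[OF hermitian_matD(1)[OF N] x(1), of c] Nx
    by (simp add: smult_smult_assoc mult.commute)
  ultimately show ?thesis using that x(1) smult_carrier_vec by blast
qed

lemma minus_mat_eq_zero_imp_eq:
  fixes A B :: "complex mat"
  assumes "A \<in> carrier_mat n m" "B \<in> carrier_mat n m" "A - B = 0\<^sub>m n m"
  shows "A = B"
proof (rule eq_matI)
  fix i j assume "i < dim_row B" "j < dim_col B"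
  then show "A $$ (i, j) = B $$ (i, j)"
    using arg_cong[OF assms(3), of "\<lambda>M. M $$ (i, j)"] assms(1,2) by simp
qed (use assms in auto)

text \<open>Induction on the number \<open>k\<close> of orthonormal eigenvectors found so far: each further one comes from
  deflating \<open>M\<close>, all inside dimension \<open>n\<close>, so that no block matrices are needed.\<close>

theorem spectral_theorem:
  assumes M: "hermitian_mat n M"
  obtains l v where "orthonormal_family n n v"
    "\<And>i. i < n \<Longrightarrow> M *\<^sub>v v i = complex_of_real (l i) \<cdot>\<^sub>v v i"
proof -
  note Mc = hermitian_matD(1)[OF M]
  have "\<exists>l v. orthonormal_family n k v \<and> (\<forall>i<k. M *\<^sub>v v i = complex_of_real (l i) \<cdot>\<^sub>v v i)"
    if "k \<le> n" for k
    using that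
  proof (induction k)
    case 0
    then show ?case by (auto simp: orthonormal_family_def)
  next
    case (Suc k)
    then obtain l v where on: "orthonormal_family n k v"
      and ev: "\<And>i. i < k \<Longrightarrow> M *\<^sub>v v i = complex_of_real (l i) \<cdot>\<^sub>v v i" by auto
    have v: "\<And>i. i < k \<Longrightarrow> v i \<in> carrier_vec n" using on unfolding orthonormal_family_def by auto
    have sumv: "spectral_sum n k c v *\<^sub>v v i = complex_of_real (c i) \<cdot>\<^sub>v v i" if "i < k" for c i
      using spectral_sum_mult_eigenvector[OF on order_refl that, of c] that by simp
    have "\<exists>x \<mu>. x \<in> carrier_vec n \<and> x \<bullet>c x = 1 \<and> (\<forall>i<k. x \<bullet>c v i = 0) \<and>
        M *\<^sub>v x = complex_of_real \<mu> \<cdot>\<^sub>v x"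
    proof (cases "M = spectral_sum n k l v")
      case False
      let ?N = "M - spectral_sum n k l v"
      have "?N \<noteq> 0\<^sub>m n n"
        using False minus_mat_eq_zero_imp_eq[OF Mc spectral_sum_carrier] by blast
      moreover have "?N *\<^sub>v v i = 0\<^sub>v n" if "i < k" for i
        using sumv[OF that] ev[OF that] v[OF that] Mc
        by (simp add: minus_mult_distrib_mat_vec[of _ n n])
      ultimately obtain x \<mu> where x: "x \<in> carrier_vec n" "x \<bullet>c x = 1"
        "\<And>i. i < k \<Longrightarrow> x \<bullet>c v i = 0" and Nx: "?N *\<^sub>v x = complex_of_real \<mu> \<cdot>\<^sub>v x"
        using hermitian_eigenvector_orthogonal[of n ?N k v]
          hermitian_mat_minus[OF M hermitian_spectral_sum] v by blast
      have "?N *\<^sub>v x = M *\<^sub>v x - 0\<^sub>v n"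
        using spectral_sum_mult_orthogonal[OF v x(1,3)] Mc x(1)
        by (simp add: minus_mult_distrib_mat_vec[of _ n n])
      also have "\<dots> = M *\<^sub>v x" using Mc by (intro eq_vecI) auto
      finally have "M *\<^sub>v x = complex_of_real \<mu> \<cdot>\<^sub>v x" using Nx by (rule trans[OF sym])
      then show ?thesis by (intro exI[of _ x] exI[of _ \<mu>] conjI allI impI x)
    next
      \<comment> \<open>Nothing is left of \<open>M\<close> after deflation, so every vector orthogonal to the \<open>v i\<close> lies in its
        kernel. The deflated identity has such an eigenvector and is nonzero for reasons of rank.\<close>
      case True
      let ?N = "1\<^sub>m n - spectral_sum n k (\<lambda>_. 1) v"
      have "?N \<noteq> 0\<^sub>m n n"
      proof
        assume "?N = 0\<^sub>m n n"
        then have "1\<^sub>m n = spectral_sum n k (\<lambda>_. 1) v"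
          by (rule minus_mat_eq_zero_imp_eq[rotated 2]) auto
        then have "vec_space.rank n (1\<^sub>m n :: complex mat) \<le> k" using rank_spectral_sum_le by metis
        moreover have "vec_space.rank n (1\<^sub>m n :: complex mat) = n"
          using vec_space.det_rank_iff[of "1\<^sub>m n :: complex mat" n] by simp
        ultimately show False using Suc.prems by simp
      qed
      moreover have "?N *\<^sub>v v i = 0\<^sub>v n" if "i < k" for i
        using sumv[OF that, of "\<lambda>_. 1"] v[OF that]
        by (simp add: minus_mult_distrib_mat_vec[of _ n n])
      ultimately obtain x \<mu> where x: "x \<in> carrier_vec n" "x \<bullet>c x = 1"
        "\<And>i. i < k \<Longrightarrow> x \<bullet>c v i = 0" and "?N *\<^sub>v x = complex_of_real \<mu> \<cdot>\<^sub>v x"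
        using hermitian_eigenvector_orthogonal[of n ?N k v]
          hermitian_mat_minus[OF hermitian_mat_one hermitian_spectral_sum] v by blast
      have "M *\<^sub>v x = complex_of_real 0 \<cdot>\<^sub>v x"
        using spectral_sum_mult_orthogonal[OF v x(1,3)] x(1) unfolding True by auto
      then show ?thesis by (intro exI[of _ x] exI[of _ 0] conjI allI impI x)
    qed
    then obtain x \<mu> where x: "x \<in> carrier_vec n" "x \<bullet>c x = 1" "\<And>i. i < k \<Longrightarrow> x \<bullet>c v i = 0"
      and Mx: "M *\<^sub>v x = complex_of_real \<mu> \<cdot>\<^sub>v x" by blast
    have vx: "v i \<bullet>c x = 0" if "i < k" for i
      using cscalar_prod_commute[OF x(1) v[OF that]] x(3)[OF that] by simp
    have "orthonormal_family n (Suc k) (v(k := x))"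
      using on x vx unfolding orthonormal_family_def by (auto simp: less_Suc_eq)
    moreover have "\<forall>i<Suc k. M *\<^sub>v (v(k := x)) i = complex_of_real ((l(k := \<mu>)) i) \<cdot>\<^sub>v (v(k := x)) i"
      using ev Mx by (auto simp: less_Suc_eq)
    ultimately show ?case by blast
  qed
  then show ?thesis using that by blast
qed

section \<open>Orthonormal bases\<close>

text \<open>The unitary matrix with columns \<open>v 0, \<dots>, v (n - 1)\<close>, when these are orthonormal.\<close>

definition basis_mat :: "nat \<Rightarrow> (nat \<Rightarrow> complex vec) \<Rightarrow> complex mat" where
  "basis_mat n v = mat n n (\<lambda>(a, i). v i $ a)"

lemma basis_mat_carrier [simp]: "basis_mat n v \<in> carrier_mat n n"
  unfolding basis_mat_def by simp

lemma basis_mat_unitary: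
  assumes on: "orthonormal_family n n v"
  shows "mat_adjoint (basis_mat n v) * basis_mat n v = 1\<^sub>m n"
    "basis_mat n v * mat_adjoint (basis_mat n v) = 1\<^sub>m n"
proof -
  let ?U = "basis_mat n v"
  show "mat_adjoint ?U * ?U = 1\<^sub>m n"
  proof (rule eq_matI)
    fix i j assume "i < dim_row (1\<^sub>m n :: complex mat)" "j < dim_col (1\<^sub>m n :: complex mat)"
    then have ij: "i < n" "j < n" by auto
    then have vi: "v i \<in> carrier_vec n" "v j \<in> carrier_vec n"
      and o: "v j \<bullet>c v i = (if i = j then 1 else 0)"
      using on unfolding orthonormal_family_def by auto
    have "(mat_adjoint ?U * ?U) $$ (i, j) = v j \<bullet>c v i"
      using ij vi unfolding basis_mat_def by (simp add: scalar_prod_def mult.commute)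
    then show "(mat_adjoint ?U * ?U) $$ (i, j) = 1\<^sub>m n $$ (i, j)" using o ij by simp
  qed (auto simp: basis_mat_def)
  then show "?U * mat_adjoint ?U = 1\<^sub>m n"
    by (rule mat_mult_left_right_inverse[OF mat_adjoint_carrier[OF basis_mat_carrier]
        basis_mat_carrier])
qed

lemma mat_eq_on_orthonormal_basis:
  assumes on: "orthonormal_family n n v" and A: "A \<in> carrier_mat n n" and B: "B \<in> carrier_mat n n"
    and eq: "\<And>i. i < n \<Longrightarrow> A *\<^sub>v v i = B *\<^sub>v v i"
  shows "A = B"
proof -
  let ?U = "basis_mat n v"
  have col: "col ?U i = v i" if "i < n" for i
  proof (rule eq_vecI)
    have vi: "v i \<in> carrier_vec n" using orthonormal_familyD(1)[OF on that] .
    then show "dim_vec (col ?U i) = dim_vec (v i)" by (simp add: basis_mat_def)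
    fix a assume "a < dim_vec (v i)"
    then show "col ?U i $ a = v i $ a"
      using that vi by (simp add: basis_mat_def)
  qed
  have "A * ?U = B * ?U"
  proof (rule mat_col_eqI)
    fix i assume "i < dim_col (B * ?U)"
    then have i: "i < n" by (simp add: basis_mat_def)
    show "col (A * ?U) i = col (B * ?U) i"
      using col_mult2[OF A basis_mat_carrier i] col_mult2[OF B basis_mat_carrier i] col[OF i] eq[OF i]
      by simp
  qed (use A B in auto)
  then have "A * ?U * mat_adjoint ?U = B * ?U * mat_adjoint ?U" by (rule arg_cong)
  then have "A * (?U * mat_adjoint ?U) = B * (?U * mat_adjoint ?U)"
    unfolding assoc_mult_mat[OF A basis_mat_carrier mat_adjoint_carrier[OF basis_mat_carrier]]
      assoc_mult_mat[OF B basis_mat_carrier mat_adjoint_carrier[OF basis_mat_carrier]] .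
  then show ?thesis unfolding basis_mat_unitary(2)[OF on] using A B by simp
qed

lemma eq_spectral_sum:
  assumes on: "orthonormal_family n n v" and M: "M \<in> carrier_mat n n"
    and ev: "\<And>i. i < n \<Longrightarrow> M *\<^sub>v v i = complex_of_real (l i) \<cdot>\<^sub>v v i"
  shows "M = spectral_sum n n l v"
proof (rule mat_eq_on_orthonormal_basis[OF on M spectral_sum_carrier])
  fix i assume i: "i < n"
  show "M *\<^sub>v v i = spectral_sum n n l v *\<^sub>v v i"
    unfolding spectral_sum_mult_eigenvector[OF on order_refl i] ev[OF i] using i by simp
qed

text \<open>Parseval's identity.\<close>

lemma quad_form_one_orthonormal:
  assumes on: "orthonormal_family n n v" and x: "x \<in> carrier_vec n"
  shows "quad_form (1\<^sub>m n) x = (\<Sum>i<n. (cmod (x \<bullet>c v i))\<^sup>2)"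
proof -
  have v: "\<And>i. i < n \<Longrightarrow> v i \<in> carrier_vec n" using on unfolding orthonormal_family_def by auto
  have "1\<^sub>m n = spectral_sum n n (\<lambda>_. 1) v"
  proof (rule eq_spectral_sum[OF on one_carrier_mat])
    fix i assume "i < n"
    then show "1\<^sub>m n *\<^sub>v v i = complex_of_real 1 \<cdot>\<^sub>v v i"
      using v[of i] by simp
  qed
  then show ?thesis using quad_form_spectral_sum[OF v x, where k = n and l = "\<lambda>_. 1"] by simp
qed

lemma quad_form_orthonormal_vec:
  assumes on: "orthonormal_family n k v" and i: "i < k" and M: "M *\<^sub>v v i = complex_of_real c \<cdot>\<^sub>v v i"
  shows "quad_form M (v i) = c"
  using orthonormal_familyD[OF on i] i unfolding quad_form_def M by simp

lemma orthonormal_vec_nonzero: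
  assumes "orthonormal_family n k v" "i < k"
  shows "v i \<noteq> 0\<^sub>v n"
  using orthonormal_familyD[OF assms] assms(2) by fastforce

section \<open>Inverses and congruences\<close>

lemma pd_mat_det_nonzero:
  assumes "pd_mat n M"
  shows "det M \<noteq> 0"
proof
  assume "det M = 0"
  then obtain x where x: "x \<in> carrier_vec n" "x \<noteq> 0\<^sub>v n" "M *\<^sub>v x = 0\<^sub>v n"
    using det_0_iff_vec_prod_zero[OF pd_matD(2)[OF assms]] by blast
  then have "quad_form M x = 0" unfolding quad_form_def by simp
  then show False using pd_matD(3)[OF assms x(1,2)] by simp
qed

lemma mat_inv_inverse:
  assumes M: "M \<in> carrier_mat n n" and d: "det M \<noteq> 0"
  shows "mat_inv M \<in> carrier_mat n n" "M * mat_inv M = 1\<^sub>m n" "mat_inv M * M = 1\<^sub>m n"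
proof -
  have "mat_inverse M \<noteq> None"
    using mat_inverse(1)[OF M, where b = "()"] det_non_zero_imp_unit[OF M d, where b = "()"] by blast
  then have "mat_inverse M = Some (mat_inv M)" unfolding mat_inv_def by auto
  from mat_inverse(2)[OF M this]
  show "mat_inv M \<in> carrier_mat n n" "M * mat_inv M = 1\<^sub>m n" "mat_inv M * M = 1\<^sub>m n" by auto
qed

lemma hermitian_mat_inv:
  assumes M: "hermitian_mat n M" and d: "det M \<noteq> 0"
  shows "mat_adjoint (mat_inv M) = mat_inv M"
proof -
  note Mc = hermitian_matD(1)[OF M]
  note inv = mat_inv_inverse[OF Mc d]
  have ai: "mat_adjoint (mat_inv M) \<in> carrier_mat n n" using inv(1) by simp
  have "mat_adjoint (mat_inv M) * M = mat_adjoint (M * mat_inv M)"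
    using mat_adjoint_mult[OF Mc inv(1)] hermitian_matD(2)[OF M] by simp
  also have "\<dots> = 1\<^sub>m n"
    unfolding inv(2) using hermitian_matD(2)[OF hermitian_mat_one] .
  finally have l: "mat_adjoint (mat_inv M) * M = 1\<^sub>m n" .
  have "mat_adjoint (mat_inv M) = mat_adjoint (mat_inv M) * (M * mat_inv M)"
    unfolding inv(2) by (rule right_mult_one_mat[OF ai, symmetric])
  also have "\<dots> = mat_adjoint (mat_inv M) * M * mat_inv M"
    by (rule assoc_mult_mat[OF ai Mc inv(1), symmetric])
  also have "\<dots> = mat_inv M" unfolding l using inv(1) by simp
  finally show ?thesis .
qed

lemma invertible_mult_vec_nonzero:
  fixes C :: "complex mat"
  assumes "C \<in> carrier_mat n n" "det C \<noteq> 0" "x \<in> carrier_vec n" "x \<noteq> 0\<^sub>v n"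
  shows "C *\<^sub>v x \<noteq> 0\<^sub>v n"
  using det_0_iff_vec_prod_zero[OF assms(1)] assms by blast

lemma quad_form_congruence:
  assumes C: "C \<in> carrier_mat n n" and K: "K \<in> carrier_mat n n" and x: "x \<in> carrier_vec n"
  shows "quad_form (mat_adjoint C * K * C) x = quad_form K (C *\<^sub>v x)"
proof -
  have C': "mat_adjoint C \<in> carrier_mat n n" and CK: "mat_adjoint C * K \<in> carrier_mat n n"
    and Cx: "C *\<^sub>v x \<in> carrier_vec n" and KCx: "K *\<^sub>v (C *\<^sub>v x) \<in> carrier_vec n"
    using C K x by auto
  have "(mat_adjoint C * K * C) *\<^sub>v x = mat_adjoint C *\<^sub>v (K *\<^sub>v (C *\<^sub>v x))"
    unfolding assoc_mult_mat_vec[OF CK C x] assoc_mult_mat_vec[OF C' K Cx] ..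
  then show ?thesis
    unfolding quad_form_def using cscalar_prod_mat_adjoint[OF C' KCx x] by simp
qed

lemma hermitian_congruence:
  assumes C: "C \<in> carrier_mat n n" and K: "hermitian_mat n K"
  shows "hermitian_mat n (mat_adjoint C * K * C)"
proof -
  note Kc = hermitian_matD(1)[OF K]
  have C': "mat_adjoint C \<in> carrier_mat n n" using C by simp
  have CK: "mat_adjoint C * K \<in> carrier_mat n n" using C' Kc by simp
  have "mat_adjoint (mat_adjoint C * K * C) = mat_adjoint C * (K * C)"
    unfolding mat_adjoint_mult[OF CK C] mat_adjoint_mult[OF C' Kc] hermitian_matD(2)[OF K]
      mat_adjoint_adjoint ..
  also have "\<dots> = mat_adjoint C * K * C" by (rule assoc_mult_mat[OF C' Kc C, symmetric])
  finally show ?thesis unfolding hermitian_mat_def using CK C by simp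
qed

lemma pd_congruence:
  assumes C: "C \<in> carrier_mat n n" and d: "det C \<noteq> 0" and K: "pd_mat n K"
  shows "pd_mat n (mat_adjoint C * K * C)"
proof -
  have "0 < quad_form (mat_adjoint C * K * C) x" if x: "x \<in> carrier_vec n" "x \<noteq> 0\<^sub>v n" for x
    unfolding quad_form_congruence[OF C pd_matD(2)[OF K] x(1)]
    using pd_matD(3)[OF K _ invertible_mult_vec_nonzero[OF C d x]] C x(1) by simp
  then show ?thesis
    unfolding pd_mat_def quad_form_def[symmetric]
    using hermitian_congruence[OF C pd_matD(1)[OF K]] by blast
qed

section \<open>The positive definite square root\<close>

lemma pd_spectral_sum:
  assumes on: "orthonormal_family n n v" and l: "\<And>i. i < n \<Longrightarrow> 0 < l i"
  shows "pd_mat n (spectral_sum n n l v)"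
proof -
  have v: "\<And>i. i < n \<Longrightarrow> v i \<in> carrier_vec n" using orthonormal_familyD(1)[OF on] .
  have "0 < quad_form (spectral_sum n n l v) x" if x: "x \<in> carrier_vec n" "x \<noteq> 0\<^sub>v n" for x
  proof -
    have "(\<Sum>i<n. (cmod (x \<bullet>c v i))\<^sup>2) \<noteq> 0"
      using quad_form_one_pos[OF x] quad_form_one_orthonormal[OF on x(1)] by simp
    then obtain i where i: "i < n" "cmod (x \<bullet>c v i) \<noteq> 0"
      by (metis (no_types, lifting) lessThan_iff power_zero_numeral sum.neutral)
    have "0 < (\<Sum>i<n. l i * (cmod (x \<bullet>c v i))\<^sup>2)"
      by (rule sum_pos2[of _ i]) (use i l in \<open>auto simp: less_imp_le\<close>)
    then show ?thesis using quad_form_spectral_sum[OF v x(1), where k = n and l = l] by simp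
  qed
  then show ?thesis
    unfolding pd_mat_def quad_form_def[symmetric] using hermitian_spectral_sum by blast
qed

text \<open>If \<open>(R - R') x = \<mu> x\<close> then \<open>0 = \<langle>(R\<^sup>2 - R'\<^sup>2) x, x\<rangle> = \<mu> (\<langle>R x, x\<rangle> + \<langle>R' x, x\<rangle>)\<close>, so
  positive definiteness leaves no nonzero eigenvalue for the Hermitian matrix \<open>R - R'\<close>.\<close>

lemma pd_sqrt_unique:
  assumes R: "pd_mat n R" and R': "pd_mat n R'" and sq: "R * R = R' * R'"
  shows "R = R'"
proof (rule ccontr)
  assume ne: "R \<noteq> R'"
  note c = pd_matD(2)[OF R] pd_matD(2)[OF R'] and h = pd_matD(1)[OF R] pd_matD(1)[OF R']
  have "R - R' \<noteq> 0\<^sub>m n n" using minus_mat_eq_zero_imp_eq[OF c] ne by blast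
  then obtain x \<mu> where x: "x \<in> carrier_vec n" "x \<noteq> 0\<^sub>v n" and \<mu>: "\<mu> \<noteq> 0"
    and Dx: "(R - R') *\<^sub>v x = complex_of_real \<mu> \<cdot>\<^sub>v x"
    using hermitian_nonzero_eigenvalue[OF hermitian_mat_minus[OF h]] by blast
  define y z where "y = R *\<^sub>v x" and "z = R' *\<^sub>v x"
  have yz: "y \<in> carrier_vec n" "z \<in> carrier_vec n" unfolding y_def z_def using c x by auto
  have diff: "y - z = complex_of_real \<mu> \<cdot>\<^sub>v x"
    using Dx minus_mult_distrib_mat_vec[OF c x(1)] unfolding y_def z_def by simp
  have "y \<bullet>c y = (R *\<^sub>v y) \<bullet>c x"
    using cscalar_prod_hermitian[OF h(1) yz(1) x(1)] unfolding y_def by simp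
  also have "R *\<^sub>v y = R' *\<^sub>v z"
    unfolding y_def z_def using assoc_mult_mat_vec[OF c(1) c(1) x(1)]
      assoc_mult_mat_vec[OF c(2) c(2) x(1)] sq by simp
  also have "\<dots> \<bullet>c x = z \<bullet>c z"
    using cscalar_prod_hermitian[OF h(2) yz(2) x(1)] unfolding z_def by simp
  finally have norms: "y \<bullet>c y = z \<bullet>c z" .
  have "complex_of_real \<mu> * (y \<bullet>c x) = y \<bullet>c (y - z)"
    unfolding diff using yz x(1) by (simp add: conjugate_smult_vec)
  also have "\<dots> = y \<bullet>c y - y \<bullet>c z"
    using yz by (simp add: scalar_prod_def atLeast0LessThan right_diff_distrib sum_subtractf)
  finally have 1: "complex_of_real \<mu> * (y \<bullet>c x) = y \<bullet>c y - y \<bullet>c z" .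
  have "complex_of_real \<mu> * (x \<bullet>c z) = (y - z) \<bullet>c z"
    unfolding diff using yz x(1) by simp
  also have "\<dots> = y \<bullet>c z - z \<bullet>c z"
    using yz by (simp add: minus_scalar_prod_distrib[of _ n])
  finally have "complex_of_real \<mu> * (y \<bullet>c x + x \<bullet>c z) = 0"
    using 1 norms by (simp add: distrib_left)
  then have "y \<bullet>c x + x \<bullet>c z = 0" using \<mu> by simp
  moreover have "x \<bullet>c z = z \<bullet>c x"
    using cscalar_prod_hermitian[OF h(2) x(1) x(1)] unfolding z_def by simp
  ultimately have "quad_form R x + quad_form R' x = 0"
    unfolding quad_form_def y_def z_def by (metis plus_complex.sel(1) zero_complex.sel(1))
  then show False using pd_matD(3)[OF R x] pd_matD(3)[OF R' x] by simp
qed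

lemma mat_sqrt_pd:
  assumes P: "pd_mat n P"
  shows "pd_mat n (mat_sqrt P)" "mat_sqrt P * mat_sqrt P = P"
proof -
  note Pc = pd_matD(2)[OF P]
  obtain l v where on: "orthonormal_family n n v"
    and ev: "\<And>i. i < n \<Longrightarrow> P *\<^sub>v v i = complex_of_real (l i) \<cdot>\<^sub>v v i"
    using spectral_theorem[OF pd_matD(1)[OF P]] by blast
  have v: "\<And>i. i < n \<Longrightarrow> v i \<in> carrier_vec n" using orthonormal_familyD(1)[OF on] .
  have l: "0 < l i" if "i < n" for i
    using pd_matD(3)[OF P v[OF that] orthonormal_vec_nonzero[OF on that]]
      quad_form_orthonormal_vec[OF on that ev[OF that]] by simp
  define R where "R = spectral_sum n n (\<lambda>i. sqrt (l i)) v"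
  have Rc: "R \<in> carrier_mat n n" unfolding R_def by simp
  have R: "pd_mat n R" unfolding R_def by (rule pd_spectral_sum[OF on]) (simp add: l)
  have RR: "R * R = P"
  proof (rule mat_eq_on_orthonormal_basis[OF on _ Pc])
    fix i assume i: "i < n"
    have Rv: "R *\<^sub>v v i = complex_of_real (sqrt (l i)) \<cdot>\<^sub>v v i"
      unfolding R_def using spectral_sum_mult_eigenvector[OF on order_refl i] i by simp
    have "(R * R) *\<^sub>v v i = complex_of_real (sqrt (l i)) \<cdot>\<^sub>v (R *\<^sub>v v i)"
      using assoc_mult_mat_vec[OF Rc Rc v[OF i]] Rv mult_mat_vec[OF Rc v[OF i]] by simp
    then show "(R * R) *\<^sub>v v i = P *\<^sub>v v i"
      unfolding Rv ev[OF i] using l[OF i] by (simp add: smult_smult_assoc flip: of_real_mult)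
  qed (use Rc in simp)
  have "mat_sqrt P = R"
    unfolding mat_sqrt_def carrier_matD(1)[OF Pc]
  proof (rule the_equality)
    fix R' assume R': "pd_mat n R' \<and> R' * R' = P"
    show "R' = R" by (rule pd_sqrt_unique[of n]) (use R' R RR in auto)
  qed (use R RR in simp)
  then show "pd_mat n (mat_sqrt P)" "mat_sqrt P * mat_sqrt P = P" using R RR by auto
qed

section \<open>The condition number as a quotient of extreme Rayleigh quotients\<close>

text \<open>The matrix is \<open>U D U\<^sup>*\<close> with \<open>D\<close> diagonal, and similar matrices share their characteristic
  polynomial.\<close>

lemma char_poly_orthonormal_eigenbasis:
  assumes on: "orthonormal_family n n v" and N: "N \<in> carrier_mat n n"
    and ev: "\<And>i. i < n \<Longrightarrow> N *\<^sub>v v i = c i \<cdot>\<^sub>v v i"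
  shows "char_poly N = (\<Prod>i\<leftarrow>[0..<n]. [:- c i, 1:])"
proof -
  let ?U = "basis_mat n v"
  define D where "D = mat n n (\<lambda>(i, j). if i = j then c i else 0)"
  have D: "D \<in> carrier_mat n n" unfolding D_def by simp
  have v: "\<And>i. i < n \<Longrightarrow> v i \<in> carrier_vec n" using orthonormal_familyD(1)[OF on] .
  have UD: "?U * D \<in> carrier_mat n n" by (rule mult_carrier_mat[OF basis_mat_carrier D])
  have "N = ?U * D * mat_adjoint ?U"
  proof (rule mat_eq_on_orthonormal_basis[OF on N])
    fix j assume j: "j < n"
    have "mat_adjoint ?U *\<^sub>v v j = unit_vec n j"
    proof (rule eq_vecI)
      fix i assume "i < dim_vec (unit_vec n j :: complex vec)"
      then have i: "i < n" by simp
      have "(mat_adjoint ?U *\<^sub>v v j) $ i = v j \<bullet>c v i"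
        using i v[OF i] v[OF j] unfolding basis_mat_def by (simp add: scalar_prod_def mult.commute)
      then show "(mat_adjoint ?U *\<^sub>v v j) $ i = unit_vec n j $ i"
        using orthonormal_familyD(2)[OF on j i] i j by (simp add: eq_commute)
    qed (simp add: basis_mat_def)
    then have "(?U * D * mat_adjoint ?U) *\<^sub>v v j = (?U * D) *\<^sub>v unit_vec n j"
      using assoc_mult_mat_vec[OF UD _ v[OF j], of "mat_adjoint ?U"] by simp
    also have "\<dots> = c j \<cdot>\<^sub>v v j"
    proof (rule eq_vecI)
      fix a assume "a < dim_vec (c j \<cdot>\<^sub>v v j)"
      then have a: "a < n" using v[OF j] by simp
      have "((?U * D) *\<^sub>v unit_vec n j) $ a = row (?U * D) a \<bullet> unit_vec n j"
        using a by (simp add: basis_mat_def)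
      also have "\<dots> = (?U * D) $$ (a, j)"
        using a j D by (simp add: scalar_prod_right_unit carrier_matD[OF basis_mat_carrier])
      also have "\<dots> = (\<Sum>i<n. v i $ a * (if i = j then c i else 0))"
        using a j unfolding basis_mat_def D_def by (simp add: scalar_prod_def atLeast0LessThan)
      also have "\<dots> = (\<Sum>i<n. if i = j then c i * v i $ a else 0)"
        by (intro sum.cong) auto
      finally show "((?U * D) *\<^sub>v unit_vec n j) $ a = (c j \<cdot>\<^sub>v v j) $ a"
        using a j v[OF j] by simp
    qed (use v[OF j] in \<open>simp add: basis_mat_def\<close>)
    finally show "N *\<^sub>v v j = (?U * D * mat_adjoint ?U) *\<^sub>v v j" using ev[OF j] by simp
  qed (use UD in simp)
  then have "similar_mat_wit N D ?U (mat_adjoint ?U)"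
    by (rule similar_mat_witI[OF basis_mat_unitary(2,1)[OF on]]) (use N D in auto)
  then have "char_poly N = char_poly D"
    using char_poly_similar unfolding similar_mat_def by blast
  also have "\<dots> = (\<Prod>a\<leftarrow>diag_mat D. [:- a, 1:])"
    by (rule char_poly_upper_triangular[OF D]) (auto simp: upper_triangular_def D_def)
  also have "diag_mat D = map c [0..<n]" unfolding diag_mat_def D_def by simp
  finally show ?thesis by (simp add: comp_def)
qed

lemma proots_linear_factors:
  fixes c :: "'b \<Rightarrow> 'a :: idom"
  shows "proots (\<Prod>i\<leftarrow>xs. [:- c i, 1:]) = mset (map c xs)"
proof (induction xs)
  case (Cons i xs)
  have "(\<Prod>i\<leftarrow>xs. [:- c i, 1:]) \<noteq> 0" by (auto simp: prod_list_zero_iff)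
  then show ?case using Cons.IH by (simp add: proots_mult del: mult_pCons_left)
qed simp

text \<open>The \<open>v i\<close> are eigenvectors of \<open>M\<^sup>* M = M\<^sup>2\<close> for the eigenvalues \<open>(l i)\<^sup>2\<close>, and \<open>l i \<ge> 0\<close>.\<close>

lemma singular_values_orthonormal_eigenbasis:
  assumes M: "hermitian_mat n M" and on: "orthonormal_family n n v"
    and ev: "\<And>i. i < n \<Longrightarrow> M *\<^sub>v v i = complex_of_real (l i) \<cdot>\<^sub>v v i"
    and l: "\<And>i. i < n \<Longrightarrow> 0 \<le> l i"
  shows "singular_values M = rev (sort (map l [0..<n]))"
proof -
  note Mc = hermitian_matD(1)[OF M]
  have v: "\<And>i. i < n \<Longrightarrow> v i \<in> carrier_vec n" using orthonormal_familyD(1)[OF on] .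
  have "(M * M) *\<^sub>v v i = complex_of_real ((l i)\<^sup>2) \<cdot>\<^sub>v v i" if "i < n" for i
    using assoc_mult_mat_vec[OF Mc Mc v[OF that]] ev[OF that] mult_mat_vec[OF Mc v[OF that]]
    by (simp add: smult_smult_assoc power2_eq_square)
  then have "char_poly (M * M) = (\<Prod>i\<leftarrow>[0..<n]. [:- complex_of_real ((l i)\<^sup>2), 1:])"
    using Mc by (intro char_poly_orthonormal_eigenbasis[OF on]) auto
  then have "proots (char_poly (M * M)) = mset (map (\<lambda>i. complex_of_real ((l i)\<^sup>2)) [0..<n])"
    by (simp only: proots_linear_factors)
  then have "image_mset (\<lambda>z. sqrt (Re z)) (proots (char_poly (M * M)))
      = mset (map (\<lambda>i. sqrt ((l i)\<^sup>2)) [0..<n])"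
    by (simp add: image_mset.compositionality comp_def)
  also have "map (\<lambda>i. sqrt ((l i)\<^sup>2)) [0..<n] = map l [0..<n]"
    using l by simp
  finally show ?thesis
    unfolding singular_values_def hermitian_matD(2)[OF M] by (simp only: sorted_list_of_multiset_mset)
qed

text \<open>The extreme singular values are the extreme eigenvalues, so they bound all Rayleigh quotients and
  are attained at eigenvectors; by Parseval a Rayleigh quotient is a weighted mean of eigenvalues.\<close>

lemma cond2_eq_rayleigh:
  assumes M: "pd_mat n M" and n: "0 < n"
  obtains b a x y where "cond2 M = b / a" "0 < a"
    "x \<in> carrier_vec n" "x \<noteq> 0\<^sub>v n" "quad_form M x = a * quad_form (1\<^sub>m n) x"
    "y \<in> carrier_vec n" "y \<noteq> 0\<^sub>v n" "quad_form M y = b * quad_form (1\<^sub>m n) y"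
    "\<And>z. z \<in> carrier_vec n \<Longrightarrow> a * quad_form (1\<^sub>m n) z \<le> quad_form M z"
    "\<And>z. z \<in> carrier_vec n \<Longrightarrow> quad_form M z \<le> b * quad_form (1\<^sub>m n) z"
proof -
  note Mc = pd_matD(2)[OF M]
  obtain l v where on: "orthonormal_family n n v"
    and ev: "\<And>i. i < n \<Longrightarrow> M *\<^sub>v v i = complex_of_real (l i) \<cdot>\<^sub>v v i"
    using spectral_theorem[OF pd_matD(1)[OF M]] by blast
  have v: "\<And>i. i < n \<Longrightarrow> v i \<in> carrier_vec n" using orthonormal_familyD(1)[OF on] .
  have v0: "\<And>i. i < n \<Longrightarrow> v i \<noteq> 0\<^sub>v n" using orthonormal_vec_nonzero[OF on] .
  have qv: "quad_form M (v i) = l i" "quad_form (1\<^sub>m n) (v i) = 1" if "i < n" for i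
    using quad_form_orthonormal_vec[OF on that ev[OF that]]
      quad_form_orthonormal_vec[OF on that, of "1\<^sub>m n" 1] v[OF that] by simp_all
  have l: "0 < l i" if "i < n" for i
    using pd_matD(3)[OF M v[OF that] v0[OF that]] qv(1)[OF that] by simp
  define xs where "xs = sort (map l [0..<n])"
  have len: "length xs = n" and sorted: "sorted xs" and set_xs: "set xs = l ` {..<n}"
    unfolding xs_def by auto
  have "singular_values M = rev xs"
    unfolding xs_def using singular_values_orthonormal_eigenbasis[OF pd_matD(1)[OF M] on ev] l
    by (simp add: less_imp_le)
  then have cond: "cond2 M = xs ! (n - 1) / xs ! 0"
    unfolding cond2_def singular_value_def using n len Mc by (simp add: rev_nth)
  obtain i j where i: "i < n" "xs ! 0 = l i" and j: "j < n" "xs ! (n - 1) = l j"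
    using nth_mem[of 0 xs] nth_mem[of "n - 1" xs] n len set_xs by auto
  have bounds: "l i \<le> l k" "l k \<le> l j" if "k < n" for k
  proof -
    have "l k \<in> set xs" using that set_xs by simp
    then obtain m where m: "m < n" "xs ! m = l k" unfolding in_set_conv_nth len by blast
    show "l i \<le> l k" "l k \<le> l j"
      using sorted_nth_mono[OF sorted, of 0 m] sorted_nth_mono[OF sorted, of m "n - 1"] m i j len
      by auto
  qed
  have qM: "quad_form M z = (\<Sum>k<n. l k * (cmod (z \<bullet>c v k))\<^sup>2)" if "z \<in> carrier_vec n" for z
    using quad_form_spectral_sum[OF v that, where k = n and l = l] eq_spectral_sum[OF on Mc ev]
    by simp
  have "l i * quad_form (1\<^sub>m n) z \<le> quad_form M z" if "z \<in> carrier_vec n" for z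
    unfolding qM[OF that] quad_form_one_orthonormal[OF on that] sum_distrib_left
    by (intro sum_mono mult_right_mono bounds) auto
  moreover have "quad_form M z \<le> l j * quad_form (1\<^sub>m n) z" if "z \<in> carrier_vec n" for z
    unfolding qM[OF that] quad_form_one_orthonormal[OF on that] sum_distrib_left
    by (intro sum_mono mult_right_mono bounds) auto
  moreover have "cond2 M = l j / l i" using cond i j by simp
  ultimately show ?thesis
    using that[of "l j" "l i" "v i" "v j"] l[OF i(1)] v[OF i(1)] v[OF j(1)] v0[OF i(1)] v0[OF j(1)]
      qv[OF i(1)] qv[OF j(1)] by simp
qed

text \<open>With \<open>R\<close> the square root of \<open>P = Q T Q\<^sup>*\<close>, the matrix \<open>C = Q\<^sup>* R\<^sup>-\<^sup>1\<close> satisfies \<open>C\<^sup>* T C = I\<close>, and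
  preconditioning \<open>Q K Q\<^sup>*\<close> by \<open>P\<close> gives \<open>C\<^sup>* K C\<close>. The substitution \<open>z = C x\<close> therefore turns Rayleigh
  quotients of the preconditioned matrix into quotients of the forms of \<open>K\<close> and \<open>T\<close>.\<close>

lemma cond2_preconditioned_eq_rayleigh:
  assumes Q: "Q \<in> carrier_mat n n" and dQ: "det Q \<noteq> 0" and n: "0 < n"
    and T: "pd_mat n T" and K: "pd_mat n K"
  defines "P \<equiv> Q * T * mat_adjoint Q"
  obtains b a x y where
    "cond2 (mat_inv (mat_sqrt P) * (Q * K * mat_adjoint Q) * mat_inv (mat_sqrt P)) = b / a" "0 < a"
    "x \<in> carrier_vec n" "x \<noteq> 0\<^sub>v n" "quad_form K x = a * quad_form T x"
    "y \<in> carrier_vec n" "y \<noteq> 0\<^sub>v n" "quad_form K y = b * quad_form T y"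
    "\<And>z. z \<in> carrier_vec n \<Longrightarrow> a * quad_form T z \<le> quad_form K z"
    "\<And>z. z \<in> carrier_vec n \<Longrightarrow> quad_form K z \<le> b * quad_form T z"
proof -
  note Tc = pd_matD(2)[OF T] and Kc = pd_matD(2)[OF K]
  have Q': "mat_adjoint Q \<in> carrier_mat n n" using Q by (rule mat_adjoint_carrier)
  have dQ': "det (mat_adjoint Q) \<noteq> 0"
  proof
    assume "det (mat_adjoint Q) = 0"
    then obtain x where x: "x \<in> carrier_vec n" "x \<noteq> 0\<^sub>v n" "mat_adjoint Q *\<^sub>v x = 0\<^sub>v n"
      using det_0_iff_vec_prod_zero[OF Q'] by blast
    define y where "y = mat_inv Q *\<^sub>v x"
    note inv = mat_inv_inverse[OF Q dQ]
    have y: "y \<in> carrier_vec n" unfolding y_def using inv(1) x(1) by simp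
    have "Q *\<^sub>v y = x"
      unfolding y_def using assoc_mult_mat_vec[OF Q inv(1) x(1)] inv(2) x(1) by simp
    then have "x \<bullet>c x = y \<bullet>c (mat_adjoint Q *\<^sub>v x)" using cscalar_prod_mat_adjoint[OF Q y x(1)] by simp
    also have "\<dots> = 0" unfolding x(3) using y by simp
    finally show False using x by simp
  qed
  have P: "pd_mat n P"
    using pd_congruence[OF Q' dQ' T] unfolding P_def mat_adjoint_adjoint .
  define R where "R = mat_sqrt P"
  have R: "pd_mat n R" and RR: "R * R = P" using mat_sqrt_pd[OF P] unfolding R_def by auto
  note Rc = pd_matD(2)[OF R] and dR = pd_mat_det_nonzero[OF R]
  define W where "W = mat_inv R"
  note inv = mat_inv_inverse[OF Rc dR, folded W_def]
  have W: "W \<in> carrier_mat n n" by (rule inv(1))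
  have dW: "det W \<noteq> 0"
  proof
    assume "det W = 0"
    then have "det (R * W) = 0" using det_mult[OF Rc W] by simp
    then show False unfolding inv(2) by simp
  qed
  define C where "C = mat_adjoint Q * W"
  have C: "C \<in> carrier_mat n n" unfolding C_def using Q' W by (rule mult_carrier_mat)
  have dC: "det C \<noteq> 0" unfolding C_def using det_mult[OF Q' W] dQ' dW by simp
  have C': "mat_adjoint C = W * Q"
    unfolding C_def mat_adjoint_mult[OF Q' W] mat_adjoint_adjoint
    using hermitian_mat_inv[OF pd_matD(1)[OF R] dR] unfolding W_def by simp
  have congr: "mat_adjoint C * N * C = W * (Q * N * mat_adjoint Q) * W" if N: "N \<in> carrier_mat n n" for N
  proof -
    have "W * Q * N * (Z * W) = W * (Q * N * Z) * W" if "Z \<in> carrier_mat n n" for Z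
      using Q W N that by (simp add: assoc_mult_mat[of _ n n _ n _ n])
    from this[OF Q'] show ?thesis unfolding C' unfolding C_def .
  qed
  have "mat_adjoint C * T * C = W * (R * R) * W" using congr[OF Tc] unfolding RR P_def by simp
  also have "\<dots> = (W * R) * (R * W)" using Rc W by (simp add: assoc_mult_mat[of _ n n _ n _ n])
  also have "\<dots> = 1\<^sub>m n" unfolding inv by simp
  finally have one: "mat_adjoint C * T * C = 1\<^sub>m n" .
  define M where "M = mat_adjoint C * K * C"
  have M: "pd_mat n M" unfolding M_def by (rule pd_congruence[OF C dC K])
  have M_eq: "M = mat_inv (mat_sqrt P) * (Q * K * mat_adjoint Q) * mat_inv (mat_sqrt P)"
    unfolding M_def congr[OF Kc] unfolding W_def R_def ..
  have qM: "quad_form M x = quad_form K (C *\<^sub>v x)"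
    and q1: "quad_form (1\<^sub>m n) x = quad_form T (C *\<^sub>v x)" if "x \<in> carrier_vec n" for x
    using quad_form_congruence[OF C Kc that] quad_form_congruence[OF C Tc that]
    unfolding M_def one by auto
  have Cx: "C *\<^sub>v x \<in> carrier_vec n" if "x \<in> carrier_vec n" for x using C that by simp
  note Cinv = mat_inv_inverse[OF C dC]
  have surj: "\<exists>x\<in>carrier_vec n. C *\<^sub>v x = z" if "z \<in> carrier_vec n" for z
    using assoc_mult_mat_vec[OF C Cinv(1) that] Cinv(1,2) that
    by (intro bexI[of _ "mat_inv C *\<^sub>v z"]) auto
  obtain b a x y where *: "cond2 M = b / a" "0 < a"
    "x \<in> carrier_vec n" "x \<noteq> 0\<^sub>v n" "quad_form M x = a * quad_form (1\<^sub>m n) x"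
    "y \<in> carrier_vec n" "y \<noteq> 0\<^sub>v n" "quad_form M y = b * quad_form (1\<^sub>m n) y"
    "\<And>z. z \<in> carrier_vec n \<Longrightarrow> a * quad_form (1\<^sub>m n) z \<le> quad_form M z"
    "\<And>z. z \<in> carrier_vec n \<Longrightarrow> quad_form M z \<le> b * quad_form (1\<^sub>m n) z"
    by (rule cond2_eq_rayleigh[OF M n]) (rule that)
  show ?thesis
  proof (rule that[of b a "C *\<^sub>v x" "C *\<^sub>v y"])
    fix z :: "complex vec" assume "z \<in> carrier_vec n"
    then obtain u where u: "u \<in> carrier_vec n" "C *\<^sub>v u = z" using surj by blast
    show "a * quad_form T z \<le> quad_form K z" "quad_form K z \<le> b * quad_form T z"
      using *(9,10)[OF u(1)] qM[OF u(1)] q1[OF u(1)] u(2) by auto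
  qed (use * Cx invertible_mult_vec_nonzero[OF C dC] qM[OF *(3)] q1[OF *(3)] qM[OF *(6)] q1[OF *(6)]
      in \<open>auto simp: M_eq\<close>)
qed

section \<open>Optimality of the truncated singular value decomposition\<close>

text \<open>A dimension count in disguise: adding to \<open>X\<close> the matrices \<open>(v i)(v i)\<^sup>*\<close> with \<open>r < i < n\<close> raises
  its rank to at most \<open>r + (n - 1 - r) < n\<close>. All summands are positive semidefinite, so each form
  vanishes at a kernel vector of the sum.\<close>

lemma psd_kernel_meets_span:
  assumes X: "psd_mat n X" and rank: "vec_space.rank n X \<le> r" and r: "r < n"
    and v: "\<And>i. i < n \<Longrightarrow> v i \<in> carrier_vec n"
  obtains w where "w \<in> carrier_vec n" "w \<noteq> 0\<^sub>v n" "quad_form X w = 0"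
    "\<And>i. r < i \<Longrightarrow> i < n \<Longrightarrow> w \<bullet>c v i = 0"
proof -
  note Xc = psd_matD(2)[OF X]
  define m where "m = n - 1 - r"
  define u where "u = (\<lambda>i. v (r + 1 + i))"
  have u: "\<And>i. i < m \<Longrightarrow> u i \<in> carrier_vec n" unfolding u_def m_def by (rule v) simp
  define E where "E = spectral_sum n m (\<lambda>_. 1) u"
  have Ec: "E \<in> carrier_mat n n" unfolding E_def by simp
  have "vec_space.rank n (X + E) \<le> r + m"
    using vec_space.rank_subadditive[OF Xc Ec] rank rank_spectral_sum_le[of n m "\<lambda>_. 1" u]
    unfolding E_def by linarith
  also have "\<dots> < n" unfolding m_def using r by simp
  finally obtain w where w: "w \<in> carrier_vec n" "w \<noteq> 0\<^sub>v n" "(X + E) *\<^sub>v w = 0\<^sub>v n"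
    using singular_mat_kernel_vec[OF add_carrier_mat[OF Ec]] by blast
  have "quad_form (X + E) w = 0" unfolding quad_form_def w(3) using w(1) by simp
  then have sum0: "quad_form X w + quad_form E w = 0" using quad_form_add[OF Xc Ec w(1)] by simp
  have qE: "quad_form E w = (\<Sum>i<m. (cmod (w \<bullet>c u i))\<^sup>2)"
    unfolding E_def using quad_form_spectral_sum[OF u w(1), where k = m and l = "\<lambda>_. 1"] by simp
  have "0 \<le> quad_form E w" unfolding qE by (simp add: sum_nonneg)
  then have X0: "quad_form X w = 0" and E0: "quad_form E w = 0"
    using sum0 psd_matD(3)[OF X w(1)] by linarith+
  have wu: "w \<bullet>c u k = 0" if "k < m" for k
    using E0 that unfolding qE by (auto simp: sum_nonneg_eq_0_iff)
  have "w \<bullet>c v i = 0" if "r < i" "i < n" for i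
  proof -
    have "i - (r + 1) < m" "u (i - (r + 1)) = v i" unfolding m_def u_def using that by auto
    then show ?thesis using wu[of "i - (r + 1)"] by simp
  qed
  then show ?thesis using that w(1,2) X0 by blast
qed

theorem theorem2:
  fixes n r :: nat and S A B Q G Gr :: "complex mat"
  assumes "Q \<in> carrier_mat n n"
    and "A = Q * mat_adjoint Q"
    and "pd_mat n A"
    and "psd_mat n B"
    and "S = A + B"
    and "G = mat_inv Q * B * mat_adjoint (mat_inv Q)"
    and "0 < r"
    and "r < vec_space.rank n B"
    and "is_truncated_svd n r G Gr"
    and "vec_space.rank n G < n"
  shows "is_arg_min
     (\<lambda>X. let P = Q * (1\<^sub>m n + X) * mat_adjoint Q
           in cond2 (mat_inv (mat_sqrt P) * S * mat_inv (mat_sqrt P)))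
     (\<lambda>X. psd_mat n X \<and> vec_space.rank n X \<le> r)
     Gr"
proof -
  note Q = assms(1) and Bc = psd_matD(2)[OF assms(4)]
  have Q': "mat_adjoint Q \<in> carrier_mat n n" using Q by (rule mat_adjoint_carrier)
  have dQ: "det Q \<noteq> 0"
    using pd_mat_det_nonzero[OF assms(3)] det_mult[OF Q Q'] unfolding assms(2) by auto
  note inv = mat_inv_inverse[OF Q dQ]
  have rn: "r < n" using assms(8) vec_space.rank_le_nc[OF Bc] by simp
  then have n: "0 < n" by simp
  have G: "psd_mat n G" using assms(9) unfolding is_truncated_svd_def by blast
  note Gc = psd_matD(2)[OF G]
  obtain l v where sd: "spectral_decomposition n G l v" and Gr: "Gr = spectral_sum n r l v"
    using assms(9) unfolding is_truncated_svd_def by blast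
  have on: "orthonormal_family n n v"
    and ev: "\<And>i. i < n \<Longrightarrow> G *\<^sub>v v i = complex_of_real (l i) \<cdot>\<^sub>v v i"
    and mono: "\<And>i j. i \<le> j \<Longrightarrow> j < n \<Longrightarrow> l j \<le> l i" and G_eq: "G = spectral_sum n n l v"
  proof -
    note sd' = sd[unfolded spectral_decomposition_def]
    show "orthonormal_family n n v"
      unfolding orthonormal_family_def using sd' by (elim conjE) (intro conjI)
    show "G *\<^sub>v v i = complex_of_real (l i) \<cdot>\<^sub>v v i" if "i < n" for i
      using sd'[THEN conjunct2, THEN conjunct2, THEN conjunct1] that by simp
    show "l j \<le> l i" if "i \<le> j" "j < n" for i j
      using sd'[THEN conjunct2, THEN conjunct2, THEN conjunct2, THEN conjunct1] that by simp
    show "G = spectral_sum n n l v"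
      using sd' by (elim conjE)
  qed
  have v: "\<And>i. i < n \<Longrightarrow> v i \<in> carrier_vec n" using orthonormal_familyD(1)[OF on] .
  have l: "0 \<le> l i" if "i < n" for i
    using psd_matD(3)[OF G v[OF that]] quad_form_orthonormal_vec[OF on that ev[OF that]] by simp
  define K where "K = 1\<^sub>m n + G"
  have K: "pd_mat n K" unfolding K_def by (rule pd_mat_one_plus_psd[OF G])

  have "Q * G * mat_adjoint Q = Q * mat_inv Q * B * (mat_adjoint (mat_inv Q) * mat_adjoint Q)"
  proof -
    have "Q * (W * B * Z) * Y = Q * W * B * (Z * Y)"
      if "W \<in> carrier_mat n n" "Z \<in> carrier_mat n n" "Y \<in> carrier_mat n n" for W Z Y
      using that Q Bc by (simp add: assoc_mult_mat[of _ n n _ n _ n])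
    from this[OF inv(1) mat_adjoint_carrier[OF inv(1)] Q'] show ?thesis unfolding assms(6) .
  qed
  also have "mat_adjoint (mat_inv Q) * mat_adjoint Q = 1\<^sub>m n"
    unfolding mat_adjoint_mult[OF Q inv(1), symmetric] inv(2)
    by (rule hermitian_matD(2)[OF hermitian_mat_one])
  finally have QGQ: "Q * G * mat_adjoint Q = B" unfolding inv(2) using Bc by simp
  have S: "S = Q * K * mat_adjoint Q"
    unfolding assms(5,2) K_def mult_add_distrib_mat[OF Q one_carrier_mat Gc] right_mult_one_mat[OF Q]
      add_mult_distrib_mat[OF Q mult_carrier_mat[OF Q Gc] Q'] QGQ ..

  let ?f = "\<lambda>X. let P = Q * (1\<^sub>m n + X) * mat_adjoint Q
           in cond2 (mat_inv (mat_sqrt P) * S * mat_inv (mat_sqrt P))"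
  have qT: "quad_form (1\<^sub>m n + X) z = quad_form (1\<^sub>m n) z + quad_form X z"
    if "psd_mat n X" "z \<in> carrier_vec n" for X z
    using quad_form_add[OF one_carrier_mat psd_matD(2)[OF that(1)] that(2)] .
  have q1: "quad_form (1\<^sub>m n) z = (\<Sum>i<n. (cmod (z \<bullet>c v i))\<^sup>2)" if "z \<in> carrier_vec n" for z
    by (rule quad_form_one_orthonormal[OF on that])
  have qG: "quad_form G z = (\<Sum>i<n. l i * (cmod (z \<bullet>c v i))\<^sup>2)" if "z \<in> carrier_vec n" for z
    unfolding G_eq by (rule quad_form_spectral_sum[OF v that])
  have qK: "quad_form K z = (\<Sum>i<n. (1 + l i) * (cmod (z \<bullet>c v i))\<^sup>2)" if "z \<in> carrier_vec n" for z
    unfolding K_def qT[OF G that] q1[OF that] qG[OF that] by (simp add: distrib_right sum.distrib)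

  have lower: "1 + l r \<le> ?f X" if X: "psd_mat n X" and rank: "vec_space.rank n X \<le> r" for X
  proof -
    let ?T = "1\<^sub>m n + X"
    have T: "pd_mat n ?T" by (rule pd_mat_one_plus_psd[OF X])
    obtain b a x y where f: "?f X = b / a" and a: "0 < a"
      and "x \<in> carrier_vec n" "x \<noteq> 0\<^sub>v n" "quad_form K x = a * quad_form ?T x"
      and "y \<in> carrier_vec n" "y \<noteq> 0\<^sub>v n" "quad_form K y = b * quad_form ?T y"
      and lo: "\<And>z. z \<in> carrier_vec n \<Longrightarrow> a * quad_form ?T z \<le> quad_form K z"
      and hi: "\<And>z. z \<in> carrier_vec n \<Longrightarrow> quad_form K z \<le> b * quad_form ?T z"
      by (rule cond2_preconditioned_eq_rayleigh[OF Q dQ n T K]) (rule that[unfolded S Let_def])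
    \<comment> \<open>The smallest quotient, tested on the kernel of \<open>G\<close>.\<close>
    obtain z where z: "z \<in> carrier_vec n" "z \<noteq> 0\<^sub>v n" "G *\<^sub>v z = 0\<^sub>v n"
      using singular_mat_kernel_vec[OF Gc assms(10)] by blast
    have "quad_form G z = 0" unfolding quad_form_def z(3) using z(1) by simp
    then have "a * quad_form ?T z \<le> quad_form (1\<^sub>m n) z"
      using lo[OF z(1)] unfolding K_def qT[OF G z(1)] by simp
    also have "\<dots> \<le> quad_form ?T z" unfolding qT[OF X z(1)] using psd_matD(3)[OF X z(1)] by simp
    finally have a1: "a \<le> 1" using pd_matD(3)[OF T z(1,2)] by (simp add: mult_le_cancel_right1)
    \<comment> \<open>The largest quotient, tested where the form of \<open>X\<close> vanishes but that of \<open>G\<close> is at least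
      \<open>l r\<close> times the squared norm.\<close>
    obtain w where w: "w \<in> carrier_vec n" "w \<noteq> 0\<^sub>v n" "quad_form X w = 0"
      and wv: "\<And>i. r < i \<Longrightarrow> i < n \<Longrightarrow> w \<bullet>c v i = 0"
      using psd_kernel_meets_span[OF X rank rn, where v = v] v by blast
    have "(1 + l r) * quad_form (1\<^sub>m n) w \<le> quad_form K w"
      unfolding q1[OF w(1)] qK[OF w(1)] sum_distrib_left
    proof (rule sum_mono)
      fix i assume "i \<in> {..<n}"
      then show "(1 + l r) * (cmod (w \<bullet>c v i))\<^sup>2 \<le> (1 + l i) * (cmod (w \<bullet>c v i))\<^sup>2"
        using mono[of i r] rn wv[of i] by (cases "i \<le> r") (auto intro: mult_right_mono)
    qed
    also have "\<dots> \<le> b * quad_form (1\<^sub>m n) w"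
      using hi[OF w(1)] unfolding qT[OF X w(1)] w(3) by simp
    finally have b: "1 + l r \<le> b" using quad_form_one_pos[OF w(1,2)] by simp
    have "1 + l r \<le> b / 1" using b by simp
    also have "b / 1 \<le> b / a" using a a1 b l[OF rn] by (intro divide_left_mono) auto
    finally show ?thesis unfolding f .
  qed

  have Gr_psd: "psd_mat n Gr" unfolding Gr by (rule psd_spectral_sum) (use rn v l in auto)
  have Gr_rank: "vec_space.rank n Gr \<le> r" unfolding Gr by (rule rank_spectral_sum_le)
  have qGr: "quad_form Gr z = (\<Sum>i<n. (if i < r then l i else 0) * (cmod (z \<bullet>c v i))\<^sup>2)"
    if z: "z \<in> carrier_vec n" for z
  proof -
    have "quad_form Gr z = (\<Sum>i<r. l i * (cmod (z \<bullet>c v i))\<^sup>2)"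
      unfolding Gr by (rule quad_form_spectral_sum) (use rn v z in auto)
    also have "\<dots> = (\<Sum>i<n. (if i < r then l i else 0) * (cmod (z \<bullet>c v i))\<^sup>2)"
      by (rule sum.mono_neutral_cong_left) (use rn in auto)
    finally show ?thesis .
  qed

  have upper: "?f Gr \<le> 1 + l r"
  proof -
    let ?T = "1\<^sub>m n + Gr"
    have T: "pd_mat n ?T" by (rule pd_mat_one_plus_psd[OF Gr_psd])
    obtain b a x y where f: "?f Gr = b / a" and a: "0 < a"
      and x: "x \<in> carrier_vec n" "x \<noteq> 0\<^sub>v n" "quad_form K x = a * quad_form ?T x"
      and y: "y \<in> carrier_vec n" "y \<noteq> 0\<^sub>v n" "quad_form K y = b * quad_form ?T y"
      and "\<And>z. z \<in> carrier_vec n \<Longrightarrow> a * quad_form ?T z \<le> quad_form K z"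
      and "\<And>z. z \<in> carrier_vec n \<Longrightarrow> quad_form K z \<le> b * quad_form ?T z"
      by (rule cond2_preconditioned_eq_rayleigh[OF Q dQ n T K]) (rule that[unfolded S Let_def])
    have qT': "quad_form ?T z = (\<Sum>i<n. (1 + (if i < r then l i else 0)) * (cmod (z \<bullet>c v i))\<^sup>2)"
      if "z \<in> carrier_vec n" for z
      unfolding qT[OF Gr_psd that] q1[OF that] qGr[OF that] by (simp add: distrib_right sum.distrib)
    have "quad_form ?T x \<le> quad_form K x"
      unfolding qT'[OF x(1)] qK[OF x(1)] by (intro sum_mono mult_right_mono) (use l in auto)
    then have a1: "1 \<le> a" using x(3) pd_matD(3)[OF T x(1,2)] by (simp add: mult_le_cancel_right1)
    have "quad_form K y \<le> (1 + l r) * quad_form ?T y"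
      unfolding qT'[OF y(1)] qK[OF y(1)] sum_distrib_left
    proof (rule sum_mono)
      fix i assume "i \<in> {..<n}"
      \<comment> \<open>For \<open>i < r\<close> the factor \<open>1 + l i\<close> occurs on both sides; for \<open>i \<ge> r\<close> use \<open>l i \<le> l r\<close>.\<close>
      then have "1 + l i \<le> (1 + l r) * (1 + (if i < r then l i else 0))"
        using mono[of r i] l[OF rn] l[of i] by (auto simp: algebra_simps)
      then show "(1 + l i) * (cmod (y \<bullet>c v i))\<^sup>2
          \<le> (1 + l r) * ((1 + (if i < r then l i else 0)) * (cmod (y \<bullet>c v i))\<^sup>2)"
        unfolding mult.assoc[symmetric] by (rule mult_right_mono) simp
    qed
    then have b: "b \<le> 1 + l r" unfolding y(3) using pd_matD(3)[OF T y(1,2)] by simp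
    have "b / a \<le> (1 + l r) / a" using b a by (intro divide_right_mono) auto
    also have "\<dots> \<le> (1 + l r) / 1" using a1 l[OF rn] by (intro divide_left_mono) auto
    finally show ?thesis unfolding f by simp
  qed

  show ?thesis
    unfolding is_arg_min_linorder
    using Gr_psd Gr_rank upper lower by (blast intro: order_trans)
qed

end
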